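(* Let $r \ge 1$, let $-1 = \xi_0 < \xi_1 < \cdots < \xi_r = 1$, and let $s_i = [\xi_{i-1}, \xi_i]$ for $i \in \{1,\ldots,r\}$. Then the set $\{s_1,\ldots,s_r\}$ is unisolvent for $\mathbb{P}_{r-1}$, and the polynomials $$\ell_{s_j}(x) = \sum_{k=j}^r \ell_{\xi_k}'(x), \quad j \in \{1,\ldots,r\},$$ form a cardinal Lagrange basis of $\mathbb{P}_{r-1}$ with respect to $\{s_1,\ldots,s_r\}$, i.e. they form a basis of $\mathbb{P}_{r-1}$ and satisfy $\int_{s_i} \ell_{s_j}(x)\,\mathrm{d}x = \delta_{ij}$ for all $i,j \in \{1,\ldots,r\}$.
   Context: $\mathbb{P}_{n}$ denotes the space of real univariate polynomials of degree at most $n$. A set of $r$ segments $\{s_1,\ldots,s_r\}$ (nondegenerate closed intervals contained in $[-1,1]$) is called unisolvent for $\mathbb{P}_{r-1}$ if for every $(\mu_1,\ldots,\mu_r)\in\mathbb{R}^r$ there is a unique $p\in\mathbb{P}_{r-1}$ with $\int_{s_i} p(x)\,\mathrm{d}x = \mu_i$ for all $i$ (equivalently, $p \in \mathbb{P}_{r-1}$ and $\int_{s_i} p(x)\,\mathrm{d}x = 0$ for all $i$ imply $p=0$). For the $r+1$ nodes $\xi_0,\ldots,\xi_r$, $\ell_{\xi_k}\in\mathbb{P}_r$ denotes the nodal Lagrange polynomial determined by $\ell_{\xi_k}(\xi_i)=\delta_{ik}$, $i,k\in\{0,\ldots,r\}$, and $\ell_{\xi_k}'$ its derivative. *)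

theory Defs
  imports "HOL-Analysis.Analysis" "HOL-Computational_Algebra.Polynomial"
begin

definition polys_upto :: "nat \<Rightarrow> real poly set" where
  "polys_upto n = {p. degree p \<le> n}"

definition is_segment :: "real set \<Rightarrow> bool" where
  "is_segment S \<longleftrightarrow> (\<exists>a b. - 1 \<le> a \<and> a < b \<and> b \<le> 1 \<and> S = {a..b})"

text \<open>A set of \<open>r\<close> segments is given by an injective enumeration \<open>s 1, \<dots>, s r\<close>.
  Only the values of \<open>s\<close> and \<open>\<mu>\<close> on \<open>{1..r}\<close> matter. The definition is meant for \<open>r \<ge> 1\<close>:
  subtraction truncates at \<open>r = 0\<close>.\<close>

definition unisolvent :: "nat \<Rightarrow> (nat \<Rightarrow> real set) \<Rightarrow> bool" where
  "unisolvent r s \<longleftrightarrow>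
     inj_on s {1..r} \<and> (\<forall>i\<in>{1..r}. is_segment (s i)) \<and>
     (\<forall>\<mu> :: nat \<Rightarrow> real.
        \<exists>!p. p \<in> polys_upto (r - 1) \<and> (\<forall>i\<in>{1..r}. integral (s i) (poly p) = \<mu> i))"

definition nodal_lagrange :: "nat \<Rightarrow> (nat \<Rightarrow> real) \<Rightarrow> nat \<Rightarrow> real poly" where
  "nodal_lagrange r \<xi> k =
     (THE p. p \<in> polys_upto r \<and> (\<forall>i\<in>{0..r}. poly p (\<xi> i) = (if i = k then 1 else 0)))"

text \<open>For distinct nodes the definite description is well-defined.\<close>

lemma nodal_lagrange_ex1:
  assumes "inj_on \<xi> {0..r}" and "k \<le> r"
  shows "\<exists>!p. p \<in> polys_upto r \<and> (\<forall>i\<in>{0..r}. poly p (\<xi> i) = (if i = k then 1 else 0))"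
proof (rule ex_ex1I)
  define J where "J = {0..r} - {k}"
  have J: "finite J" "card J = r" using assms(2) by (auto simp: J_def)
  define q where "q = (\<Prod>j\<in>J. [:- \<xi> j, 1:])"
  have ne: "\<xi> k \<noteq> \<xi> j" if "j \<in> J" for j
    using that assms by (auto simp: J_def inj_on_def)
  have qk: "poly q (\<xi> k) \<noteq> 0" using ne J by (auto simp: q_def poly_prod)
  have q0: "poly q (\<xi> i) = 0" if "i \<in> J" for i
    using that J by (auto simp: q_def poly_prod)
  have "degree q \<le> (\<Sum>j\<in>J. degree [:- \<xi> j, 1:])"
    unfolding q_def using degree_prod_sum_le[OF J(1), of "\<lambda>j. [:- \<xi> j, 1:]"] by (simp add: o_def)
  hence "degree q \<le> r" using J by simp
  thus "\<exists>p. p \<in> polys_upto r \<and> (\<forall>i\<in>{0..r}. poly p (\<xi> i) = (if i = k then 1 else 0))"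
    using qk q0 by (intro exI[of _ "smult (1 / poly q (\<xi> k)) q"])
      (auto simp: polys_upto_def J_def)
next
  fix p q
  assume p: "p \<in> polys_upto r \<and> (\<forall>i\<in>{0..r}. poly p (\<xi> i) = (if i = k then 1 else 0))"
    and q: "q \<in> polys_upto r \<and> (\<forall>i\<in>{0..r}. poly q (\<xi> i) = (if i = k then 1 else 0))"
  show "p = q"
  proof (rule ccontr)
    assume "p \<noteq> q"
    hence d: "p - q \<noteq> 0" by simp
    have "card (\<xi> ` {0..r}) \<le> card {x. poly (p - q) x = 0}"
      using p q by (intro card_mono poly_roots_finite d) auto
    also have "\<dots> \<le> degree (p - q)" by (rule card_poly_roots_bound[OF d])
    also have "\<dots> \<le> r" using p q degree_diff_le by (auto simp: polys_upto_def)
    finally show False using card_image[OF assms(1)] by simp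
  qed
qed

text \<open>\<open>real poly\<close> is not an instance of \<open>real_vector\<close>; its vector space structure is
  given by the locale \<open>vector_space\<close> with scalar multiplication \<open>smult\<close>.\<close>

lemma vector_space_smult: "vector_space (smult :: real \<Rightarrow> real poly \<Rightarrow> real poly)"
  by unfold_locales (simp_all add: smult_add_right smult_add_left)

definition is_basis_family :: "nat \<Rightarrow> (nat \<Rightarrow> real poly) \<Rightarrow> real poly set \<Rightarrow> bool" where
  "is_basis_family r b V \<longleftrightarrow>
     inj_on b {1..r} \<and> \<not> module.dependent smult (b ` {1..r}) \<and>
     module.span smult (b ` {1..r}) = V"

definition cardinal_lagrange_basis :: "nat \<Rightarrow> (nat \<Rightarrow> real set) \<Rightarrow> (nat \<Rightarrow> real poly) \<Rightarrow> bool" where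
  "cardinal_lagrange_basis r s b \<longleftrightarrow>
     is_basis_family r b (polys_upto (r - 1)) \<and>
     (\<forall>i\<in>{1..r}. \<forall>j\<in>{1..r}. integral (s i) (poly (b j)) = (if i = j then 1 else 0))"

end

theory Submission
  imports Defs
begin

text \<open>The segments tile \<open>[-1, 1]\<close>, so integrals over them are increments of a primitive, and
  everything becomes a statement about the values of primitives at the nodes.

  If \<open>p\<close> has degree at most \<open>r - 1\<close> and zero integral over every segment, a primitive of \<open>p\<close>
  takes the same value at all \<open>r + 1\<close> nodes; having degree at most \<open>r\<close>, it is constant, so \<open>p = 0\<close>
  (\<open>poly_eq_0_if_integrals_0\<close>). Dually, the primitive \<open>\<Sum>k=j..r. nodal_lagrange r \<xi> k\<close> of \<open>L j\<close>
  is a discrete step function: it is \<open>0\<close> at the nodes before \<open>\<xi> j\<close> and \<open>1\<close> from \<open>\<xi> j\<close> on, so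
  its only increment is over the segment that ends at \<open>\<xi> j\<close> (\<open>integral_step_pderiv\<close>).

  The rest is linear algebra: a family dual to a set of functionals with trivial
  common kernel is a basis, and it interpolates arbitrary data
  (\<open>cardinal_family_unisolvent\<close>, \<open>cardinal_family_basis\<close>).\<close>

section \<open>Primitives of polynomials\<close>

lemma integral_pderiv:
  fixes P :: "real poly"
  assumes "a \<le> b"
  shows "integral {a..b} (poly (pderiv P)) = poly P b - poly P a"
  by (intro integral_unique fundamental_theorem_of_calculus assms)
    (simp add: poly_DERIV has_field_derivative_at_within
      flip: has_real_derivative_iff_has_vector_derivative)

lemma pderiv_sum: "pderiv (\<Sum>i\<in>A. p i) = (\<Sum>i\<in>A. pderiv (p i))"
  using higher_pderiv_sum[of 1 p A] by simp

lemma ex_primitive_poly: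
  fixes p :: "'a :: field_char_0 poly"
  shows "\<exists>P. pderiv P = p"
proof
  let ?P = "\<Sum>i\<le>degree p. monom (coeff p i / of_nat (Suc i)) (Suc i)"
  have "pderiv ?P = (\<Sum>i\<le>degree p. monom (coeff p i) i)"
    using of_nat_neq_0[where 'a = 'a]
    by (simp add: pderiv_sum pderiv_monom del: of_nat_Suc)
  then show "pderiv ?P = p"
    by (simp add: poly_as_sum_of_monoms)
qed

text \<open>Each vanishing integral says that a primitive agrees at two consecutive nodes. Subtracting
  its common value gives a polynomial of degree at most \<open>r\<close> with \<open>r + 1\<close> roots.\<close>

lemma poly_eq_0_if_integrals_0:
  fixes \<xi> :: "nat \<Rightarrow> real"
  assumes mono: "strict_mono_on {0..r} \<xi>" and "r \<ge> 1" and deg: "degree p \<le> r - 1"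
    and int: "\<And>i. i \<in> {1..r} \<Longrightarrow> integral {\<xi> (i - 1)..\<xi> i} (poly p) = 0"
  shows "p = 0"
proof -
  obtain P where P: "pderiv P = p" using ex_primitive_poly by blast
  have "degree P \<le> r"
    using deg \<open>r \<ge> 1\<close> degree_pderiv[of P, unfolded P] by linarith
  have const: "poly P (\<xi> i) = poly P (\<xi> 0)" if "i \<le> r" for i
    using that
  proof (induction i)
    case (Suc i)
    have "\<xi> i \<le> \<xi> (Suc i)"
      using strict_mono_onD[OF mono, of i "Suc i"] Suc.prems by simp
    then show ?case
      using int[of "Suc i"] Suc integral_pderiv[of "\<xi> i" "\<xi> (Suc i)" P] P by simp
  qed simp
  have "P = [:poly P (\<xi> 0):]"
  proof (rule ccontr)
    define Q where "Q = P - [:poly P (\<xi> 0):]"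
    assume "P \<noteq> [:poly P (\<xi> 0):]"
    then have "Q \<noteq> 0" by (simp add: Q_def)
    have "Suc r = card (\<xi> ` {0..r})"
      using card_image[OF strict_mono_on_imp_inj_on[OF mono]] by simp
    also have "\<dots> \<le> card {x. poly Q x = 0}"
    proof (intro card_mono poly_roots_finite \<open>Q \<noteq> 0\<close> image_subsetI CollectI)
      fix i assume "i \<in> {0..r}"
      then show "poly Q (\<xi> i) = 0" using const[of i] by (simp add: Q_def)
    qed
    also have "\<dots> \<le> degree Q"
      by (rule card_poly_roots_bound[OF \<open>Q \<noteq> 0\<close>])
    also have "\<dots> \<le> r"
      unfolding Q_def using \<open>degree P \<le> r\<close> by (intro degree_diff_le) auto
    finally show False by simp
  qed
  then have "pderiv P = pderiv [:poly P (\<xi> 0):]" by metis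
  then show ?thesis using P by (simp add: pderiv_pCons)
qed

section \<open>Families dual to integration over segments\<close>

lemma integral_segment_lincomb:
  assumes "is_segment S"
  shows "integral S (poly (\<Sum>j\<in>A. smult (c j) (b j))) = (\<Sum>j\<in>A. c j * integral S (poly (b j)))"
proof -
  obtain u v where S: "S = {u..v}"
    using assms unfolding is_segment_def by blast
  have int: "poly q integrable_on S" for q
    unfolding S by (intro integrable_continuous_real continuous_intros)
  have "integral S (poly (\<Sum>j\<in>A. smult (c j) (b j)))
      = integral S (\<lambda>x. \<Sum>j\<in>A. c j * poly (b j) x)"
    by (intro integral_cong) (simp add: poly_sum)
  also have "\<dots> = (\<Sum>j\<in>A. c j * integral S (poly (b j)))"
  proof (cases "finite A")
    case True
    then have "integral S (\<lambda>x. \<Sum>j\<in>A. c j * poly (b j) x)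
        = (\<Sum>j\<in>A. integral S (\<lambda>x. c j * poly (b j) x))"
      by (intro integral_sum integrable_on_mult_right int)
    then show ?thesis by simp
  qed simp
  finally show ?thesis .
qed

text \<open>This isolates what the linear algebra uses of the nodes: duality (\<open>cardinal\<close>) gives
  existence and independence, injectivity of the integrals on the space (\<open>kernel\<close>) gives
  uniqueness and spanning.\<close>

locale cardinal_family =
  fixes r :: nat and s :: "nat \<Rightarrow> real set" and b :: "nat \<Rightarrow> real poly"
  assumes segment: "i \<in> {1..r} \<Longrightarrow> is_segment (s i)"
    and upto: "j \<in> {1..r} \<Longrightarrow> b j \<in> polys_upto (r - 1)"
    and cardinal: "\<lbrakk>i \<in> {1..r}; j \<in> {1..r}\<rbrakk> \<Longrightarrow>
      integral (s i) (poly (b j)) = (if i = j then 1 else 0)"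
    and kernel: "\<lbrakk>p \<in> polys_upto (r - 1); \<forall>i\<in>{1..r}. integral (s i) (poly p) = 0\<rbrakk> \<Longrightarrow> p = 0"
begin

lemma lincomb_upto: "(\<Sum>j\<in>{1..r}. smult (c j) (b j)) \<in> polys_upto (r - 1)"
  unfolding polys_upto_def mem_Collect_eq
  by (intro degree_sum_le) (use upto in \<open>auto simp: polys_upto_def intro: degree_smult_le[THEN order_trans]\<close>)

lemma integral_lincomb:
  assumes i: "i \<in> {1..r}"
  shows "integral (s i) (poly (\<Sum>j\<in>{1..r}. smult (c j) (b j))) = c i"
proof -
  have "integral (s i) (poly (\<Sum>j\<in>{1..r}. smult (c j) (b j)))
      = (\<Sum>j\<in>{1..r}. if i = j then c j else 0)"
    unfolding integral_segment_lincomb[OF segment[OF i]]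
    by (intro sum.cong) (auto simp: cardinal[OF i])
  also have "\<dots> = c i"
    using i by (subst sum.delta') auto
  finally show ?thesis .
qed

lemma eq_if_integrals_eq:
  assumes "p \<in> polys_upto (r - 1)" "q \<in> polys_upto (r - 1)"
    and eq: "\<And>i. i \<in> {1..r} \<Longrightarrow> integral (s i) (poly p) = integral (s i) (poly q)"
  shows "p = q"
proof -
  have "integral (s i) (poly (p - q)) = 0" if i: "i \<in> {1..r}" for i
  proof -
    obtain u v where S: "s i = {u..v}"
      using segment[OF i] unfolding is_segment_def by blast
    have "poly q' integrable_on s i" for q'
      unfolding S by (intro integrable_continuous_real continuous_intros)
    moreover have "poly (p - q) = (\<lambda>x. poly p x - poly q x)" by auto
    ultimately show ?thesis
      using integral_diff[of "poly p" "s i" "poly q"] eq[OF i] by simp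
  qed
  moreover have "p - q \<in> polys_upto (r - 1)"
    using assms(1,2) by (simp add: polys_upto_def degree_diff_le)
  ultimately show ?thesis using kernel[of "p - q"] by simp
qed

lemma cardinal_family_unisolvent:
  assumes "inj_on s {1..r}"
  shows "unisolvent r s"
  unfolding unisolvent_def
proof (intro conjI ballI allI ex_ex1I)
  fix \<mu> :: "nat \<Rightarrow> real"
  show "\<exists>p. p \<in> polys_upto (r - 1) \<and> (\<forall>i\<in>{1..r}. integral (s i) (poly p) = \<mu> i)"
    using lincomb_upto integral_lincomb by blast
next
  fix \<mu> :: "nat \<Rightarrow> real" and p q
  assume "p \<in> polys_upto (r - 1) \<and> (\<forall>i\<in>{1..r}. integral (s i) (poly p) = \<mu> i)"
    and "q \<in> polys_upto (r - 1) \<and> (\<forall>i\<in>{1..r}. integral (s i) (poly q) = \<mu> i)"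
  then show "p = q" by (intro eq_if_integrals_eq) auto
qed (use assms segment in auto)

text \<open>Integrating over \<open>s i\<close> reads off the \<open>i\<close>-th coefficient of a linear combination. This
  gives independence, and also spanning: \<open>p\<close> and the combination of the \<open>b j\<close> with
  coefficients \<open>integral (s j) (poly p)\<close> have the same integrals.\<close>

lemma cardinal_family_basis: "cardinal_lagrange_basis r s b"
  unfolding cardinal_lagrange_basis_def is_basis_family_def
proof (intro conjI ballI)
  interpret V: vector_space "smult :: real \<Rightarrow> real poly \<Rightarrow> real poly"
    by (rule vector_space_smult)
  show inj: "inj_on b {1..r}"
  proof (rule inj_onI)
    fix i j assume "i \<in> {1..r}" "j \<in> {1..r}" "b i = b j"
    then show "i = j" using cardinal[of i i] cardinal[of i j] by (auto split: if_splits)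
  qed
  show "\<not> V.dependent (b ` {1..r})"
  proof
    assume "V.dependent (b ` {1..r})"
    then obtain u i where i: "i \<in> {1..r}" "u (b i) \<noteq> 0"
      and "(\<Sum>v\<in>b ` {1..r}. smult (u v) v) = 0"
      by (auto simp: V.dependent_finite)
    then have "(\<Sum>j\<in>{1..r}. smult (u (b j)) (b j)) = 0"
      by (simp only: sum.reindex[OF inj] o_def)
    moreover have "poly 0 = (\<lambda>x :: real. 0 :: real)" by auto
    ultimately show False
      using integral_lincomb[OF i(1), of "\<lambda>j. u (b j)"] i(2) by simp
  qed
  show "V.span (b ` {1..r}) = polys_upto (r - 1)"
  proof
    have "V.subspace (polys_upto (r - 1))"
      by (auto simp: V.subspace_def polys_upto_def degree_add_le
          intro: degree_smult_le[THEN order_trans])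
    then show "V.span (b ` {1..r}) \<subseteq> polys_upto (r - 1)"
      using upto by (intro V.span_minimal) auto
  next
    show "polys_upto (r - 1) \<subseteq> V.span (b ` {1..r})"
    proof
      fix p assume p: "p \<in> polys_upto (r - 1)"
      have "p = (\<Sum>j\<in>{1..r}. smult (integral (s j) (poly p)) (b j))"
        by (intro eq_if_integrals_eq p lincomb_upto) (simp only: integral_lincomb)
      also have "\<dots> \<in> V.span (b ` {1..r})"
        by (intro V.span_sum V.span_scale V.span_base imageI)
      finally show "p \<in> V.span (b ` {1..r})" .
    qed
  qed
qed (use cardinal in auto)

end

section \<open>Sums of derivatives of nodal polynomials\<close>

lemma nodal_lagrange:
  assumes "inj_on \<xi> {0..r}" "k \<le> r"
  shows degree_nodal_lagrange: "degree (nodal_lagrange r \<xi> k) \<le> r"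
    and poly_nodal_lagrange: "i \<le> r \<Longrightarrow> poly (nodal_lagrange r \<xi> k) (\<xi> i) = (if i = k then 1 else 0)"
  using theI'[OF nodal_lagrange_ex1[OF assms], folded nodal_lagrange_def]
  by (auto simp: polys_upto_def)

text \<open>Tail sums of the nodal polynomials interpolate the step from \<open>0\<close> to \<open>1\<close> across the
  \<open>j\<close>-th segment, and the integral of the derivative is the height of the step.\<close>

lemma integral_step_pderiv:
  fixes \<xi> :: "nat \<Rightarrow> real"
  assumes mono: "strict_mono_on {0..r} \<xi>" and "i \<in> {1..r}" "j \<in> {1..r}"
  shows "integral {\<xi> (i - 1)..\<xi> i} (poly (\<Sum>k=j..r. pderiv (nodal_lagrange r \<xi> k)))
    = (if i = j then 1 else 0)"
proof -
  note inj = strict_mono_on_imp_inj_on[OF mono]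
  have step: "poly (\<Sum>k=j..r. nodal_lagrange r \<xi> k) (\<xi> m) = (if j \<le> m then 1 else 0)"
    if "m \<le> r" for m
  proof -
    have "poly (\<Sum>k=j..r. nodal_lagrange r \<xi> k) (\<xi> m) = (\<Sum>k=j..r. if m = k then 1 else 0)"
      unfolding poly_sum by (intro sum.cong) (use that in \<open>auto simp: poly_nodal_lagrange[OF inj]\<close>)
    then show ?thesis using that by simp
  qed
  have "i - 1 \<le> r" "i \<le> r"
    using assms(2) by auto
  moreover have "\<xi> (i - 1) \<le> \<xi> i"
    using strict_mono_onD[OF mono, of "i - 1" i] assms(2) by simp
  ultimately have "integral {\<xi> (i - 1)..\<xi> i} (poly (pderiv (\<Sum>k=j..r. nodal_lagrange r \<xi> k)))
      = (if j \<le> i then 1 else 0) - (if j \<le> i - 1 then 1 else 0)"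
    by (simp only: integral_pderiv step)
  also have "\<dots> = (if i = j then 1 else 0)"
    using assms(2) by auto
  finally show ?thesis by (simp add: pderiv_sum)
qed

theorem proposition3p2:
  fixes r :: nat and \<xi> :: "nat \<Rightarrow> real"
    and s :: "nat \<Rightarrow> real set" and L :: "nat \<Rightarrow> real poly"
  assumes "r \<ge> 1"
    and "\<xi> 0 = - 1" and "\<xi> r = 1"
    and "strict_mono_on {0..r} \<xi>"
    and "\<And>i. i \<in> {1..r} \<Longrightarrow> s i = {\<xi> (i - 1)..\<xi> i}"
    and "\<And>j. j \<in> {1..r} \<Longrightarrow> L j = (\<Sum>k=j..r. pderiv (nodal_lagrange r \<xi> k))"
  shows "unisolvent r s \<and> cardinal_lagrange_basis r s L"
proof -
  note mono = assms(4) and s = assms(5) and L = assms(6)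
  note inj = strict_mono_on_imp_inj_on[OF mono]
  have less: "\<xi> (i - 1) < \<xi> i" if "i \<in> {1..r}" for i
    using strict_mono_onD[OF mono, of "i - 1" i] that by simp
  have le: "\<xi> i \<le> \<xi> k" if "i \<le> k" "k \<le> r" for i k
    using strict_mono_onD[OF mono, of i k] that by (cases "i = k") auto
  interpret cardinal_family r s L
  proof
    fix i assume i: "i \<in> {1..r}"
    have "- 1 \<le> \<xi> (i - 1)" "\<xi> i \<le> 1"
      using le[of 0 "i - 1"] le[of i r] i assms(2,3) by auto
    then show "is_segment (s i)"
      unfolding is_segment_def using less[OF i] s[OF i] by blast
  next
    fix j assume j: "j \<in> {1..r}"
    have "degree (pderiv (nodal_lagrange r \<xi> k)) \<le> r - 1" if "k \<in> {j..r}" for k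
      using that degree_nodal_lagrange[OF inj, of k] by (simp add: degree_pderiv diff_le_mono)
    then show "L j \<in> polys_upto (r - 1)"
      unfolding L[OF j] polys_upto_def mem_Collect_eq by (intro degree_sum_le) auto
  next
    fix i j assume "i \<in> {1..r}" "j \<in> {1..r}"
    then show "integral (s i) (poly (L j)) = (if i = j then 1 else 0)"
      using integral_step_pderiv[OF mono] by (simp only: s L)
  next
    fix p assume "p \<in> polys_upto (r - 1)" "\<forall>i\<in>{1..r}. integral (s i) (poly p) = 0"
    then show "p = 0"
      by (intro poly_eq_0_if_integrals_0[OF mono \<open>r \<ge> 1\<close>]) (simp_all add: polys_upto_def s)
  qed
  have "inj_on s {1..r}"
  proof (rule inj_onI)
    fix i k assume ik: "i \<in> {1..r}" "k \<in> {1..r}" "s i = s k"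
    then have "\<xi> i = \<xi> k"
      using less[of i] less[of k] s[of i] s[of k] by (simp add: Icc_eq_Icc)
    then show "i = k" using inj ik by (auto dest: inj_onD)
  qed
  then show ?thesis
    using cardinal_family_unisolvent cardinal_family_basis by blast
qed

end
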